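(* Let $Q=[-1,1]^{\infty}$ be the Hilbert cube, let $S\subseteq Q$ be a subset, and let $x,y\in Q\setminus S$. Suppose that $S$ intersects every continuum from $x$ to $y$, i.e. $S\cap C\neq\emptyset$ for every compact connected subset $C\subseteq Q$ with $x,y\in C$. Then $S$ (with the subspace topology) is strongly infinite dimensional.
   Context: $Q=\prod_{n=1}^{\infty}[-1,1]$ has the product topology. A continuum is a compact connected set. For disjoint closed subsets $A,B$ of a space $X$, a separator between $A$ and $B$ is a closed subset $L\subseteq X$ such that $X\setminus L$ is the disjoint union of open sets $U$ and $V$ with $A\subseteq U$ and $B\subseteq V$. A family $\{(A_i,B_i): i\in\Gamma\}$ of pairs of disjoint closed subsets of $X$ is essential if for every family $\{L_i: i\in\Gamma\}$, where $L_i$ is a separator between $A_i$ and $B_i$, one has $\bigcap_{i\in\Gamma}L_i\neq\emptyset$. A space $X$ is strongly infinite dimensional if there exists an infinite essential family of pairs of disjoint closed subsets of $X$. *)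

theory Defs
  imports "HOL-Analysis.Analysis"
begin

definition hilbert_cube :: "(nat \<Rightarrow> real) topology" where
  "hilbert_cube = product_topology (\<lambda>_. top_of_set {-1..1}) UNIV"

definition continuum_in :: "'a topology \<Rightarrow> 'a set \<Rightarrow> bool" where
  "continuum_in X C \<longleftrightarrow> compactin X C \<and> connectedin X C"

definition separator :: "'a topology \<Rightarrow> 'a set \<Rightarrow> 'a set \<Rightarrow> 'a set \<Rightarrow> bool" where
  "separator X A B L \<longleftrightarrow> closedin X L \<and>
     (\<exists>U V. openin X U \<and> openin X V \<and> disjnt U V \<and> topspace X - L = U \<union> V \<and>
            A \<subseteq> U \<and> B \<subseteq> V)"

(* The intersection is taken inside the space, so that it is topspace X when I = {}. *)
definition essential_family ::
  "'a topology \<Rightarrow> 'i set \<Rightarrow> ('i \<Rightarrow> 'a set) \<Rightarrow> ('i \<Rightarrow> 'a set) \<Rightarrow> bool" where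
  "essential_family X I A B \<longleftrightarrow>
     (\<forall>i\<in>I. closedin X (A i) \<and> closedin X (B i) \<and> disjnt (A i) (B i)) \<and>
     (\<forall>L. (\<forall>i\<in>I. separator X (A i) (B i) (L i)) \<longrightarrow> topspace X \<inter> (\<Inter>i\<in>I. L i) \<noteq> {})"

(* HOL cannot quantify existentially over the type of an index set, so the family is an infinite
   set F of pairs, indexed by itself; it may have any cardinality.  In a normal space (such as a
   subspace of the Hilbert cube) this loses no families: two copies of one pair have disjoint
   separators, so an essential indexed family never repeats a pair. *)
definition strongly_infinite_dimensional :: "'a topology \<Rightarrow> bool" where
  "strongly_infinite_dimensional X \<longleftrightarrow>
     (\<exists>F :: ('a set \<times> 'a set) set. infinite F \<and> essential_family X F fst snd)"

end

theory Submission
  imports Defs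
begin

text \<open>
  Since \<open>x \<noteq> y\<close>, some coordinate \<open>k\<close> distinguishes them. Map the cube to itself so that the faces
  \<open>z k = -1\<close> and \<open>z k = 1\<close> collapse to \<open>x\<close> and \<open>y\<close> and the map is injective elsewhere; the preimage \<open>T\<close>
  of \<open>S\<close> then meets every continuum joining these two faces. The essential family consists of the
  images in \<open>S\<close> of the slabs \<open>z i \<le> -1/2\<close> and \<open>1/2 \<le> z i\<close> for \<open>i \<noteq> k\<close>. Indeed, given separators in \<open>S\<close>,
  pull them back to \<open>T\<close> and extend them to separators between opposite faces of the cube. The extensions
  have a common continuum joining the two \<open>k\<close>-faces: otherwise one could cut their intersection by a
  separator in direction \<open>k\<close> and obtain a family of face separators with empty intersection, against the
  infinite-dimensional form of the Poincare-Miranda theorem. This continuum meets \<open>T\<close>.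
\<close>

section \<open>The Hilbert cube as a compact metrizable space\<close>

abbreviation cube :: "(nat \<Rightarrow> real) set" where
  "cube \<equiv> {z. \<forall>i. \<bar>z i\<bar> \<le> 1}"

text \<open>The class topology on functions is the product topology, so facts about
  \<open>closed\<close>, \<open>continuous_on\<close> and \<open>compact\<close> become available
  for the cube.\<close>

lemma hilbert_cube_eq: "hilbert_cube = top_of_set cube"
proof -
  have "hilbert_cube = subtopology (product_topology (\<lambda>_. euclidean) UNIV) (\<Pi>\<^sub>E i\<in>(UNIV::nat set). {-1..1::real})"
    unfolding hilbert_cube_def by (simp add: subtopology_product_topology)
  moreover have "(\<Pi>\<^sub>E i\<in>(UNIV::nat set). {-1..1::real}) = cube"
    by (simp add: PiE_def Pi_def abs_le_iff minus_le_iff conj_commute)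
  ultimately show ?thesis
    by (simp add: euclidean_product_topology)
qed

lemma topspace_hilbert_cube [simp]: "topspace hilbert_cube = cube"
  by (simp add: hilbert_cube_eq)

lemma compact_space_hilbert_cube: "compact_space hilbert_cube"
  unfolding hilbert_cube_def
  by (simp add: compact_space_product_topology compact_space_subtopology)

lemma metrizable_space_hilbert_cube: "metrizable_space hilbert_cube"
  unfolding hilbert_cube_eq
  by (intro metrizable_space_subtopology metrizable_space_euclidean)

lemma seq_compact_cube: "seq_compact cube"
proof -
  have "compact cube"
    using compact_space_hilbert_cube by (simp add: hilbert_cube_eq compact_space_subtopology compactin_subtopology compact_space_def)
  then show ?thesis
    by (rule compact_imp_seq_compact)
qed

lemma tendsto_coordinatewise:
  fixes f :: "'a \<Rightarrow> 'b \<Rightarrow> 'c::topological_space"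
  assumes "\<And>j. ((\<lambda>n. f n j) \<longlongrightarrow> l j) F"
  shows "(f \<longlongrightarrow> l) F"
  using assms limitin_componentwise[of "\<lambda>_. euclidean" "UNIV :: 'b set" f l F]
  by (simp add: euclidean_product_topology)

lemma closedin_hilbert_cube_Collect_le:
  "closedin hilbert_cube {z \<in> cube. z i \<le> a}" "closedin hilbert_cube {z \<in> cube. a \<le> z i}"
proof -
  have "closed {z::nat \<Rightarrow> real. z i \<le> a}" "closed {z::nat \<Rightarrow> real. a \<le> z i}"
    by (intro closed_Collect_le continuous_on_const continuous_on_product_coordinates)+
  then show "closedin hilbert_cube {z \<in> cube. z i \<le> a}" "closedin hilbert_cube {z \<in> cube. a \<le> z i}"
    unfolding hilbert_cube_eq by (simp_all only: Collect_conj_eq Collect_mem_eq closedin_closed_Int)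
qed

lemma openin_hilbert_cube_Collect_less:
  "openin hilbert_cube {z \<in> cube. z i < a}" "openin hilbert_cube {z \<in> cube. a < z i}"
proof -
  have "{z \<in> cube. z i < a} = cube - {z \<in> cube. a \<le> z i}" "{z \<in> cube. a < z i} = cube - {z \<in> cube. z i \<le> a}"
    by auto
  then show "openin hilbert_cube {z \<in> cube. z i < a}" "openin hilbert_cube {z \<in> cube. a < z i}"
    using closedin_hilbert_cube_Collect_le[where i = i and a = a] by (simp_all only: closedin_def topspace_hilbert_cube)
qed

section \<open>Separators and their extension from a subspace\<close>

lemma separator_of_open:
  assumes U: "openin X U" and V: "openin X V" and "disjnt U V" "A \<subseteq> U" "B \<subseteq> V"
  shows "separator X A B (topspace X - (U \<union> V))"
proof -
  have "closedin X (topspace X - (U \<union> V))"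
    using U V by (intro closedin_diff closedin_topspace openin_Un)
  moreover have "topspace X - (topspace X - (U \<union> V)) = U \<union> V"
    using openin_subset[OF U] openin_subset[OF V] by blast
  ultimately show ?thesis
    unfolding separator_def using assms by metis
qed

text \<open>The neighbourhoods \<open>G\<close> and \<open>H\<close> keep the two sides of the separator in \<open>T\<close> away from \<open>B\<close> and
  \<open>A\<close>, so that adding \<open>A\<close> and \<open>B\<close> leaves the sides separated in \<open>X\<close>.\<close>

lemma separator_extension:
  assumes X: "metrizable_space X" and T: "T \<subseteq> topspace X"
    and L: "separator (subtopology X T) A' B' L"
    and A: "closedin X A" "A \<subseteq> G" "openin X G" "T \<inter> G \<subseteq> A'"
    and B: "closedin X B" "B \<subseteq> H" "openin X H" "T \<inter> H \<subseteq> B'"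
    and AB: "disjnt A B"
  obtains M where "separator X A B M" "T \<inter> M \<subseteq> L"
proof -
  have "topspace (subtopology X T) = T"
    using T by (rule topspace_subtopology_subset)
  obtain U V where U: "openin (subtopology X T) U" and V: "openin (subtopology X T) V"
    and UV: "disjnt U V" "T - L = U \<union> V" "A' \<subseteq> U" "B' \<subseteq> V"
    using L unfolding separator_def \<open>topspace (subtopology X T) = T\<close> by blast
  \<comment> \<open>Separatedness does not depend on the ambient space, so it passes from
    \<open>T\<close> to \<open>X\<close>, although \<open>U\<close> and \<open>V\<close> need not be
    open in \<open>X\<close>.\<close>
  have sUV: "separatedin X U V"
    using separatedin_open_sets[OF U V] UV(1) separatedin_subtopology[of X T U V] by simp
  have sub: "U \<subseteq> T" "V \<subseteq> T"
    using UV(2) by blast+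
  have "V \<inter> G = {}" "U \<inter> H = {}"
    using A(4) B(4) UV(1,3,4) sub unfolding disjnt_def by blast+
  then have "G \<inter> X closure_of V = {}" "H \<inter> X closure_of U = {}"
    using openin_Int_closure_of_eq_empty[OF A(3)] openin_Int_closure_of_eq_empty[OF B(3)]
    by (simp_all add: Int_commute)
  then have "A \<inter> X closure_of V = {}" "B \<inter> X closure_of U = {}"
    using A(2) B(2) by blast+
  moreover have "V \<inter> A = {}" "U \<inter> B = {}"
    using \<open>V \<inter> G = {}\<close> \<open>U \<inter> H = {}\<close> A(2) B(2) by blast+
  ultimately have "separatedin X U B" "separatedin X A V" "separatedin X A B"
    using AB sUV A(1) B(1)
    by (simp_all add: separatedin_def closure_of_closedin closedin_subset disjnt_def Int_commute)
  then have "separatedin X (U \<union> A) (V \<union> B)"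
    using sUV by (simp add: separatedin_Un)
  \<comment> \<open>The two sets are separated but in general not closed, so normality alone would
    not give disjoint neighbourhoods; metrizability does.\<close>
  from metrizable_space_separation[OF X this]
  obtain U' V' where U': "openin X U'" "openin X V'" "U \<union> A \<subseteq> U'" "V \<union> B \<subseteq> V'" "disjnt U' V'"
    by blast
  show thesis
  proof
    show "separator X A B (topspace X - (U' \<union> V'))"
      using U' by (intro separator_of_open) auto
    have "T - L \<subseteq> U' \<union> V'"
      using U'(3,4) unfolding UV(2) by blast
    then show "T \<inter> (topspace X - (U' \<union> V')) \<subseteq> L"
      by blast
  qed
qed

section \<open>A Poincare-Miranda theorem for the Hilbert cube\<close>

text \<open>Kuhn's labelling lemma is applied to ever finer grids on the first \<open>n + 1\<close> coordinates, a vertex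
  being labelled by the sides of the separators it lies on. Compactness gives a limit of the resulting
  cells, each of which has, for every \<open>i \<le> n\<close>, vertices with different labels in direction \<open>i\<close>.\<close>

lemma faces_essential:
  assumes "\<And>i. separator hilbert_cube {z \<in> cube. z i \<le> -1} {z \<in> cube. 1 \<le> z i} (M i)"
  shows "cube \<inter> (\<Inter>i. M i) \<noteq> {}"
proof -
  define P where "P i U V \<longleftrightarrow> openin hilbert_cube U \<and> openin hilbert_cube V \<and> disjnt U V \<and> cube - M i = U \<union> V \<and>
      {z \<in> cube. z i \<le> -1} \<subseteq> U \<and> {z \<in> cube. 1 \<le> z i} \<subseteq> V" for i U V
  have "\<forall>i. \<exists>U V. P i U V"
    using assms unfolding separator_def P_def topspace_hilbert_cube by blast
  then obtain U V where "\<And>i. P i (U i) (V i)"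
    by metis
  then have UV: "\<And>i. openin hilbert_cube (U i)" "\<And>i. openin hilbert_cube (V i)"
    "\<And>i. disjnt (U i) (V i)" "\<And>i. cube - M i = U i \<union> V i"
    and faces: "\<And>i. {z \<in> cube. z i \<le> -1} \<subseteq> U i" "\<And>i. {z \<in> cube. 1 \<le> z i} \<subseteq> V i"
    unfolding P_def by blast+
  \<comment> \<open>The integers from 0 to \<open>Suc n\<close> are spread evenly over [-1,1]. The
    number of subdivisions and the dimension are both \<open>Suc n\<close>, so a single limit
    refines the mesh and exhausts the coordinates; those beyond \<open>n\<close> are set to
    0.\<close>
  define grid :: "nat \<Rightarrow> (nat \<Rightarrow> nat) \<Rightarrow> nat \<Rightarrow> real"
    where "grid n x = (\<lambda>i. if i \<le> n then 2 * real (x i) / real (Suc n) - 1 else 0)" for n x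
  have grid_cube: "grid n x \<in> cube" if "\<And>i. i \<le> n \<Longrightarrow> x i \<le> Suc n" for n x
  proof -
    have "\<bar>grid n x i\<bar> \<le> 1" for i
    proof (cases "i \<le> n")
      case True
      then have "real (x i) \<le> real (Suc n)"
        using that of_nat_mono by blast
      then have "2 * real (x i) / real (Suc n) \<le> 2"
        by (simp add: divide_le_eq)
      then show ?thesis
        using True by (simp add: grid_def abs_le_iff)
    qed (simp add: grid_def)
    then show ?thesis
      by blast
  qed
  \<comment> \<open>Label 1 covers \<open>V i\<close> as well as points of \<open>M i\<close>; the
    limit argument uses only that one vertex of a cell lies in \<open>U i\<close> and another does
    not.\<close>
  define label :: "nat \<Rightarrow> (nat \<Rightarrow> nat) \<Rightarrow> nat \<Rightarrow> nat"
    where "label n x i = (if grid n x \<in> U i then 0 else 1)" for n x i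
  have "\<exists>q. (\<forall>i<Suc n. q i < Suc n) \<and> (\<forall>i<Suc n. \<exists>r s. (\<forall>j<Suc n. q j \<le> r j \<and> r j \<le> q j + 1) \<and>
      (\<forall>j<Suc n. q j \<le> s j \<and> s j \<le> q j + 1) \<and> label n r i \<noteq> label n s i)" for n
  proof -
    have zero: "label n x i = 0" if "\<forall>i<Suc n. x i \<le> Suc n" "i < Suc n" "x i = 0" for x i
    proof -
      have "grid n x \<in> {z \<in> cube. z i \<le> -1}"
        using that grid_cube[of n x] by (simp add: grid_def)
      then show ?thesis
        using faces(1)[of i] unfolding label_def by auto
    qed
    have one: "label n x i = 1" if "\<forall>i<Suc n. x i \<le> Suc n" "i < Suc n" "x i = Suc n" for x i
    proof -
      have "grid n x i = 1"
        using that by (simp add: grid_def field_simps)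
      then have "grid n x \<in> {z \<in> cube. 1 \<le> z i}"
        using that grid_cube[of n x] by simp
      then show ?thesis
        using faces(2)[of i] UV(3)[of i] unfolding label_def disjnt_def by auto
    qed
    have "label n x i = 0 \<or> label n x i = 1" for x i
      by (simp add: label_def)
    with zero one obtain q where "\<forall>i<Suc n. q i < Suc n"
      and "\<forall>i<Suc n. \<exists>r s. (\<forall>j<Suc n. q j \<le> r j \<and> r j \<le> q j + 1) \<and>
        (\<forall>j<Suc n. q j \<le> s j \<and> s j \<le> q j + 1) \<and> label n r i \<noteq> label n s i"
      by (elim kuhn_lemma[of "Suc n" "Suc n" "label n", rotated 4]) (assumption | simp)+
    then show ?thesis
      by blast
  qed
  then obtain q where q: "\<And>n i. i \<le> n \<Longrightarrow> q n i \<le> n"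
    and rs: "\<And>n i. i \<le> n \<Longrightarrow> \<exists>r s. (\<forall>j\<le>n. q n j \<le> r j \<and> r j \<le> q n j + 1) \<and>
      (\<forall>j\<le>n. q n j \<le> s j \<and> s j \<le> q n j + 1) \<and> label n r i \<noteq> label n s i"
    unfolding less_Suc_eq_le by metis
  have near_cube: "grid n s \<in> cube" if "\<forall>j\<le>n. q n j \<le> s j \<and> s j \<le> q n j + 1" for n s
  proof (rule grid_cube)
    show "s i \<le> Suc n" if "i \<le> n" for i
      using \<open>\<forall>j\<le>n. q n j \<le> s j \<and> s j \<le> q n j + 1\<close> q[OF that] that by fastforce
  qed
  have "\<forall>n. grid n (q n) \<in> cube"
    using near_cube by simp
  from seq_compactE[OF seq_compact_cube this]
  obtain l \<sigma> where l: "l \<in> cube" and \<sigma>: "strict_mono (\<sigma> :: nat \<Rightarrow> nat)"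
    and lim: "((\<lambda>n. grid n (q n)) \<circ> \<sigma>) \<longlonglongrightarrow> l"
    by blast
  have \<sigma>_top: "filterlim \<sigma> at_top sequentially"
    using \<sigma> by (rule filterlim_subseq)
  \<comment> \<open>Any choice of vertices in the cells has the same limit as the corners: in each
    coordinate they differ by at most one mesh width, 2 / \<open>Suc (\<sigma> n)\<close>, and
    beyond \<open>\<sigma> n\<close> both vanish.\<close>
  have near_in: "\<forall>\<^sub>F n in sequentially. grid (\<sigma> n) (s n) \<in> W"
    if s: "\<And>n j. j \<le> \<sigma> n \<Longrightarrow> q (\<sigma> n) j \<le> s n j \<and> s n j \<le> q (\<sigma> n) j + 1"
      and W: "openin hilbert_cube W" "l \<in> W" for s W
  proof -
    have "((\<lambda>n. grid (\<sigma> n) (s n)) \<longlongrightarrow> l) sequentially"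
    proof (rule tendsto_coordinatewise)
      fix j
      have "(\<lambda>n. grid (\<sigma> n) (q (\<sigma> n)) j) \<longlonglongrightarrow> l j"
        using continuous_on_tendsto_compose[OF continuous_on_product_coordinates[of j] lim]
        by (simp add: o_def)
      moreover have "(\<lambda>n. grid (\<sigma> n) (s n) j - grid (\<sigma> n) (q (\<sigma> n)) j) \<longlonglongrightarrow> 0"
      proof (rule Lim_null_comparison)
        show "\<forall>\<^sub>F n in sequentially. norm (grid (\<sigma> n) (s n) j - grid (\<sigma> n) (q (\<sigma> n)) j) \<le> 2 * inverse (real (Suc (\<sigma> n)))"
        proof (rule always_eventually, rule allI)
          fix n
          show "norm (grid (\<sigma> n) (s n) j - grid (\<sigma> n) (q (\<sigma> n)) j) \<le> 2 * inverse (real (Suc (\<sigma> n)))"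
          proof (cases "j \<le> \<sigma> n")
            case True
            then have "grid (\<sigma> n) (s n) j - grid (\<sigma> n) (q (\<sigma> n)) j
                = 2 * inverse (real (Suc (\<sigma> n))) * (real (s n j) - real (q (\<sigma> n) j))"
              by (simp add: grid_def divide_inverse algebra_simps)
            moreover have "\<bar>real (s n j) - real (q (\<sigma> n) j)\<bar> \<le> 1"
              using s[OF True] by auto
            ultimately show ?thesis
              by (simp add: abs_mult mult_left_le del: of_nat_Suc)
          qed (simp add: grid_def)
        qed
        show "(\<lambda>n. 2 * inverse (real (Suc (\<sigma> n)))) \<longlonglongrightarrow> 0"
          using tendsto_mult_right_zero[OF filterlim_compose[OF LIMSEQ_inverse_real_of_nat \<sigma>_top]] by simp
      qed
      ultimately show "(\<lambda>n. grid (\<sigma> n) (s n) j) \<longlonglongrightarrow> l j"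
        using tendsto_add by fastforce
    qed
    moreover obtain W' where "open W'" "W = cube \<inter> W'"
      using W unfolding hilbert_cube_eq openin_open by blast
    ultimately show ?thesis
      using W near_cube s topological_tendstoD[of _ l sequentially W']
      by (auto elim!: eventually_mono)
  qed
  have "l \<in> M i" for i
  proof (rule ccontr)
    assume "l \<notin> M i"
    \<comment> \<open>The two vertices with different labels are named so that \<open>r\<close> is
      the one in \<open>U i\<close>. While \<open>i\<close> exceeds \<open>\<sigma> n\<close> the
      grid has no direction \<open>i\<close>, and the corner serves as a default for both.\<close>
    have "\<exists>r s. (\<forall>j\<le>\<sigma> n. q (\<sigma> n) j \<le> r j \<and> r j \<le> q (\<sigma> n) j + 1) \<and> (\<forall>j\<le>\<sigma> n. q (\<sigma> n) j \<le> s j \<and> s j \<le> q (\<sigma> n) j + 1) \<and>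
        (i \<le> \<sigma> n \<longrightarrow> grid (\<sigma> n) r \<in> U i \<and> grid (\<sigma> n) s \<notin> U i)" for n
    proof (cases "i \<le> \<sigma> n")
      case True
      then show ?thesis
        using rs[OF True] unfolding label_def by (metis (full_types))
    next
      case False
      then show ?thesis
        by (intro exI[of _ "q (\<sigma> n)"]) auto
    qed
    then obtain r s where r: "\<And>n j. j \<le> \<sigma> n \<Longrightarrow> q (\<sigma> n) j \<le> r n j \<and> r n j \<le> q (\<sigma> n) j + 1"
      and s: "\<And>n j. j \<le> \<sigma> n \<Longrightarrow> q (\<sigma> n) j \<le> s n j \<and> s n j \<le> q (\<sigma> n) j + 1"
      and in_U: "\<And>n. i \<le> \<sigma> n \<Longrightarrow> grid (\<sigma> n) (r n) \<in> U i \<and> grid (\<sigma> n) (s n) \<notin> U i"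
      by metis
    have large: "\<forall>\<^sub>F n in sequentially. i \<le> \<sigma> n"
      using \<sigma>_top by (simp add: filterlim_at_top)
    have "l \<in> U i \<or> l \<in> V i"
      using UV(4)[of i] l \<open>l \<notin> M i\<close> by blast
    \<comment> \<open>Whichever of the open sets \<open>U i\<close> and \<open>V i\<close> contains
      \<open>l\<close> eventually contains both vertices; but \<open>s\<close> is never in
      \<open>U i\<close>, and \<open>r\<close>, being in \<open>U i\<close>, is never in
      \<open>V i\<close>.\<close>
    then have "\<forall>\<^sub>F n in sequentially. False"
    proof
      assume "l \<in> U i"
      then have "\<forall>\<^sub>F n in sequentially. grid (\<sigma> n) (s n) \<in> U i"
        using s UV(1) by (intro near_in) auto
      then show ?thesis using large
        by (rule eventually_elim2) (use in_U in auto)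
    next
      assume "l \<in> V i"
      then have "\<forall>\<^sub>F n in sequentially. grid (\<sigma> n) (r n) \<in> V i"
        using r UV(2) by (intro near_in) auto
      then show ?thesis using large
        by (rule eventually_elim2) (use in_U UV(3)[of i] in \<open>auto simp: disjnt_iff\<close>)
    qed
    then show False
      by simp
  qed
  with l show ?thesis
    by blast
qed

section \<open>Continua inside intersections of separators\<close>

text \<open>If no continuum in the intersection \<open>K\<close> joins the two
  \<open>k\<close>-faces, the cut-wire fence theorem splits \<open>K\<close> into closed pieces, one
  for each face. Normality enlarges these to open sets of the cube, whose complement is a separator
  in direction \<open>k\<close> that misses \<open>K\<close>.\<close>

lemma continuum_in_separators:
  assumes M: "\<And>i. i \<noteq> k \<Longrightarrow> separator hilbert_cube {z \<in> cube. z i \<le> -1} {z \<in> cube. 1 \<le> z i} (M i)"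
  obtains C where "continuum_in hilbert_cube C" "\<And>i. i \<noteq> k \<Longrightarrow> C \<subseteq> M i"
    "\<exists>z\<in>C. z k = -1" "\<exists>z\<in>C. z k = 1"
proof (rule ccontr)
  assume no: "\<not> thesis"
  let ?A = "{z \<in> cube. z k \<le> -1}" and ?B = "{z \<in> cube. 1 \<le> z k}"
  define K where "K = cube \<inter> (\<Inter>i\<in>-{k}. M i)"
  have "closedin hilbert_cube (\<Inter>(insert cube (M ` (-{k}))))"
    using M closedin_topspace[of hilbert_cube] by (intro closedin_Inter) (auto simp: separator_def)
  then have K: "closedin hilbert_cube K"
    by (simp add: K_def)
  then have sub: "K \<subseteq> cube"
    by (auto simp: K_def)
  have AB: "closedin hilbert_cube ?A" "closedin hilbert_cube ?B"
    by (rule closedin_hilbert_cube_Collect_le)+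
  have "separated_between (subtopology hilbert_cube K) (K \<inter> ?A) (K \<inter> ?B)"
  proof (rule cut_wire_fence_theorem)
    show "compact_space (subtopology hilbert_cube K)"
      by (rule compact_space_subtopology[OF closedin_compact_space[OF compact_space_hilbert_cube K]])
    show "Hausdorff_space (subtopology hilbert_cube K)"
      by (intro Hausdorff_space_subtopology metrizable_imp_Hausdorff_space metrizable_space_hilbert_cube)
    show "closedin (subtopology hilbert_cube K) (K \<inter> ?A)" "closedin (subtopology hilbert_cube K) (K \<inter> ?B)"
      using AB by (auto simp: closedin_subtopology)
    fix D
    assume "connectedin (subtopology hilbert_cube K) D"
    then have D: "connectedin hilbert_cube D" "D \<subseteq> K"
      by (auto simp: connectedin_subtopology)
    \<comment> \<open>The cut-wire fence theorem concerns all connected sets, the assumption only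
      compact ones; the closure bridges the gap and stays in the closed set
      \<open>K\<close>.\<close>
    define C where "C = hilbert_cube closure_of D"
    have "D \<subseteq> C" "C \<subseteq> K"
      using D sub K by (auto simp: C_def closure_of_minimal closure_of_subset)
    moreover have "continuum_in hilbert_cube C"
      using D(1) compact_space_hilbert_cube
      by (simp add: C_def continuum_in_def closedin_compact_space connectedin_closure_of)
    ultimately have *: "\<not> ((\<exists>z\<in>D. z k = -1) \<and> (\<exists>z\<in>D. z k = 1))"
    proof (intro notI)
      assume "(\<exists>z\<in>D. z k = -1) \<and> (\<exists>z\<in>D. z k = 1)"
      moreover have "C \<subseteq> M i" if "i \<noteq> k" for i
        using that \<open>C \<subseteq> K\<close> by (auto simp: K_def)
      ultimately show False
        using no that[of C] \<open>continuum_in hilbert_cube C\<close> \<open>D \<subseteq> C\<close> by blast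
    qed
    \<comment> \<open>Inside the cube the inequalities that describe the faces are
      equalities.\<close>
    have "z k = -1" if "z \<in> D" "z k \<le> -1" for z
      using that D sub by (force simp: abs_le_iff dest: spec[of _ k])
    moreover have "z k = 1" if "z \<in> D" "1 \<le> z k" for z
      using that D sub by (force simp: abs_le_iff dest: spec[of _ k])
    ultimately show "disjnt D (K \<inter> ?A) \<or> disjnt D (K \<inter> ?B)"
      using * by (auto simp: disjnt_iff)
  qed
  moreover have top_K: "topspace (subtopology hilbert_cube K) = K"
    using sub by (intro topspace_subtopology_subset) simp
  ultimately obtain U V where "closedin (subtopology hilbert_cube K) U" "closedin (subtopology hilbert_cube K) V"
    and UV: "U \<union> V = K" "disjnt U V" "K \<inter> ?A \<subseteq> U" "K \<inter> ?B \<subseteq> V"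
    unfolding separated_between_alt top_K by blast
  then have "closedin hilbert_cube U" "closedin hilbert_cube V"
    by (auto intro: closedin_trans_full[OF _ K])
  \<comment> \<open>The whole faces are added, not just their traces on \<open>K\<close>, so that
    the open sets obtained below separate the faces in the cube.\<close>
  then have "closedin hilbert_cube (U \<union> ?A)" "closedin hilbert_cube (V \<union> ?B)"
    using AB by (auto intro: closedin_Un)
  moreover have "disjnt (U \<union> ?A) (V \<union> ?B)"
  proof -
    have "U \<inter> ?B = {}" "V \<inter> ?A = {}"
      using UV unfolding disjnt_def by blast+
    moreover have "?A \<inter> ?B = {}"
      by auto
    ultimately show ?thesis
      using UV(2) unfolding disjnt_def by blast
  qed
  ultimately have "\<exists>U' V'. openin hilbert_cube U' \<and> openin hilbert_cube V' \<and>
      U \<union> ?A \<subseteq> U' \<and> V \<union> ?B \<subseteq> V' \<and> disjnt U' V'"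
    using metrizable_imp_normal_space[OF metrizable_space_hilbert_cube]
    unfolding normal_space_def by meson
  then obtain U' V' where U': "openin hilbert_cube U'" "openin hilbert_cube V'"
    "U \<union> ?A \<subseteq> U'" "V \<union> ?B \<subseteq> V'" "disjnt U' V'"
    by blast
  \<comment> \<open>Nothing is assumed about \<open>M k\<close>, so the separator just built takes
    its place.\<close>
  define N where "N = M(k := topspace hilbert_cube - (U' \<union> V'))"
  have "separator hilbert_cube {z \<in> cube. z i \<le> -1} {z \<in> cube. 1 \<le> z i} (N i)" for i
  proof (cases "i = k")
    case True
    have "separator hilbert_cube ?A ?B (topspace hilbert_cube - (U' \<union> V'))"
      using U'(3,4) by (intro separator_of_open U'(1,2,5)) blast+
    then show ?thesis
      using True by (simp add: N_def)
  next
    case False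
    then show ?thesis
      using M[OF False] by (simp add: N_def)
  qed
  \<comment> \<open>A common point lies in \<open>K\<close>, which \<open>U'\<close> and
    \<open>V'\<close> cover, and also in \<open>N k\<close>, which avoids them both.\<close>
  from faces_essential[OF this] obtain z where z: "z \<in> cube" "\<And>i. z \<in> N i"
    by auto
  have "z \<in> M i" if "i \<noteq> k" for i
    using z(2)[of i] that by (simp add: N_def)
  then have "z \<in> K"
    using z(1) by (auto simp: K_def)
  moreover have "z \<notin> U' \<union> V'"
    using z(2)[of k] by (simp add: N_def)
  ultimately show False
    using UV(1) U'(3,4) by blast
qed

text \<open>The slabs reach to 1/2 while the faces lie at distance 1 from the centre. The gap leaves
  room for the open sets \<open>z i < -1/2\<close> and \<open>1/2 < z i\<close>, the neighbourhoods
  needed to extend the separators from \<open>T\<close> to the cube.\<close>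

lemma separators_meet:
  assumes T: "T \<subseteq> cube"
    and meets: "\<And>C. \<lbrakk>continuum_in hilbert_cube C; \<exists>z\<in>C. z k = -1; \<exists>z\<in>C. z k = 1\<rbrakk> \<Longrightarrow> T \<inter> C \<noteq> {}"
    and L: "\<And>i. i \<noteq> k \<Longrightarrow>
      separator (subtopology hilbert_cube T) {z \<in> T. z i \<le> -1/2} {z \<in> T. 1/2 \<le> z i} (L i)"
  shows "T \<inter> (\<Inter>i\<in>-{k}. L i) \<noteq> {}"
proof -
  have "\<exists>M. separator hilbert_cube {z \<in> cube. z i \<le> -1} {z \<in> cube. 1 \<le> z i} M \<and> T \<inter> M \<subseteq> L i"
    if "i \<noteq> k" for i
  proof -
    have *: "{z \<in> cube. z i \<le> -1} \<subseteq> {z \<in> cube. z i < -1/2}" "T \<inter> {z \<in> cube. z i < -1/2} \<subseteq> {z \<in> T. z i \<le> -1/2}"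
      "{z \<in> cube. 1 \<le> z i} \<subseteq> {z \<in> cube. 1/2 < z i}" "T \<inter> {z \<in> cube. 1/2 < z i} \<subseteq> {z \<in> T. 1/2 \<le> z i}"
      "disjnt {z \<in> cube. z i \<le> -1} {z \<in> cube. 1 \<le> z i}"
      by (auto simp: disjnt_iff)
    have T_top: "T \<subseteq> topspace hilbert_cube"
      using T by simp
    show ?thesis
    proof (rule separator_extension[OF metrizable_space_hilbert_cube T_top L[OF that]
        closedin_hilbert_cube_Collect_le(1) *(1) openin_hilbert_cube_Collect_less(1) *(2)
        closedin_hilbert_cube_Collect_le(2) *(3) openin_hilbert_cube_Collect_less(2) *(4,5)])
      fix M
      assume "separator hilbert_cube {z \<in> cube. z i \<le> -1} {z \<in> cube. 1 \<le> z i} M" "T \<inter> M \<subseteq> L i"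
      then show ?thesis
        by blast
    qed
  qed
  then have "\<forall>i. \<exists>M. i \<noteq> k \<longrightarrow> separator hilbert_cube {z \<in> cube. z i \<le> -1} {z \<in> cube. 1 \<le> z i} M \<and> T \<inter> M \<subseteq> L i"
    by blast
  from choice[OF this] obtain M where M: "\<And>i. i \<noteq> k \<Longrightarrow> separator hilbert_cube {z \<in> cube. z i \<le> -1} {z \<in> cube. 1 \<le> z i} (M i)"
    and M_sub: "\<And>i. i \<noteq> k \<Longrightarrow> T \<inter> M i \<subseteq> L i"
    by blast
  from continuum_in_separators[OF M]
  obtain C where "continuum_in hilbert_cube C" and CM: "\<And>i. i \<noteq> k \<Longrightarrow> C \<subseteq> M i"
    and "\<exists>z\<in>C. z k = -1" "\<exists>z\<in>C. z k = 1"
    by blast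
  then obtain z where "z \<in> T" "z \<in> C"
    using meets[of C] by blast
  then have "z \<in> L i" if "i \<noteq> k" for i
    using CM[OF that] M_sub[OF that] by blast
  with \<open>z \<in> T\<close> show ?thesis
    by blast
qed

section \<open>Transport along continuous maps\<close>

lemma separator_vimage:
  assumes f: "continuous_map X Y f" and L: "separator Y A B L"
    and A': "A' \<subseteq> topspace X" "f ` A' \<subseteq> A" and B': "B' \<subseteq> topspace X" "f ` B' \<subseteq> B"
  shows "separator X A' B' {z \<in> topspace X. f z \<in> L}"
proof -
  let ?pre = "\<lambda>W. {z \<in> topspace X. f z \<in> W}"
  obtain U V where UV: "openin Y U" "openin Y V" "disjnt U V" "topspace Y - L = U \<union> V" "A \<subseteq> U" "B \<subseteq> V"
    using L unfolding separator_def by blast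
  have "f z \<in> topspace Y" if "z \<in> topspace X" for z
    using continuous_map_image_subset_topspace[OF f] that by blast
  then have "topspace X - ?pre L = ?pre U \<union> ?pre V"
    using UV(4) by blast
  moreover have "openin X (?pre U)" "openin X (?pre V)"
    using UV(1,2) openin_continuous_map_preimage[OF f] by blast+
  moreover have "disjnt (?pre U) (?pre V)"
    using UV(3) by (auto simp: disjnt_iff)
  moreover have "closedin X (?pre L)"
    using L closedin_continuous_map_preimage[OF f] unfolding separator_def by blast
  moreover have "A' \<subseteq> ?pre U" "B' \<subseteq> ?pre V"
    using A' B' UV(5,6) by blast+
  ultimately show ?thesis
    unfolding separator_def
    by (intro conjI exI[of _ "?pre U"] exI[of _ "?pre V"])
qed

lemma continuum_in_image:
  assumes "continuous_map X Y f" "continuum_in X C"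
  shows "continuum_in Y (f ` C)"
  using assms unfolding continuum_in_def
  by (blast intro: image_compactin connectedin_continuous_map_image)

section \<open>A map collapsing two opposite faces to \<open>x\<close> and \<open>y\<close>\<close>

text \<open>The cross-sections of the cube orthogonal to the axis \<open>k\<close> shrink to \<open>x\<close> and \<open>y\<close> at the two ends.\<close>

definition spindle :: "nat \<Rightarrow> (nat \<Rightarrow> real) \<Rightarrow> (nat \<Rightarrow> real) \<Rightarrow> (nat \<Rightarrow> real) \<Rightarrow> nat \<Rightarrow> real" where
  "spindle k x y z = (\<lambda>n. let s = (1 + z k) / 2; r = s * (1 - s); c = (1 - s) * x n + s * y n
     in if n = k then c else (1 - r) * c + r * z n)"

lemma abs_convex_combination_le:
  fixes a b t :: real
  assumes "\<bar>a\<bar> \<le> 1" "\<bar>b\<bar> \<le> 1" "0 \<le> t" "t \<le> 1"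
  shows "\<bar>(1 - t) * a + t * b\<bar> \<le> 1"
proof -
  have "\<bar>(1 - t) * a + t * b\<bar> \<le> (1 - t) * \<bar>a\<bar> + t * \<bar>b\<bar>"
    using assms abs_triangle_ineq[of "(1 - t) * a" "t * b"] by (simp add: abs_mult)
  also have "\<dots> \<le> 1"
    using assms by (intro convex_bound_le) auto
  finally show ?thesis .
qed

text \<open>Coordinate \<open>k\<close> is a convex combination of \<open>x k\<close> and
  \<open>y k\<close>; every other coordinate mixes such a combination with \<open>z n\<close>, the
  latter with weight \<open>s * (1 - s)\<close>, which is 0 exactly at the two ends.\<close>

lemma spindle_in_cube:
  assumes "x \<in> cube" "y \<in> cube" "z \<in> cube"
  shows "spindle k x y z \<in> cube"
proof -
  define s where "s = (1 + z k) / 2"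
  have "\<bar>z k\<bar> \<le> 1"
    using assms by simp
  then have s: "0 \<le> s" "s \<le> 1"
    by (auto simp: s_def abs_le_iff)
  then have r: "0 \<le> s * (1 - s)" "s * (1 - s) \<le> 1"
    by (auto intro: mult_le_one)
  have c: "\<bar>(1 - s) * x n + s * y n\<bar> \<le> 1" for n
    using assms s by (intro abs_convex_combination_le) auto
  then have "\<bar>(1 - s * (1 - s)) * ((1 - s) * x n + s * y n) + s * (1 - s) * z n\<bar> \<le> 1" for n
    using assms(3) by (intro abs_convex_combination_le[OF _ _ r]) simp_all
  with c show ?thesis
    by (simp add: spindle_def Let_def flip: s_def)
qed

lemma continuous_map_spindle:
  assumes "x \<in> cube" "y \<in> cube"
  shows "continuous_map hilbert_cube hilbert_cube (spindle k x y)"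
proof -
  have coord: "continuous_on cube (\<lambda>z. z n)" for n :: nat
    by (rule continuous_on_subset[OF continuous_on_product_coordinates]) simp
  have "continuous_on cube (\<lambda>z. spindle k x y z n)" for n
    unfolding spindle_def Let_def by (cases "n = k") (auto intro!: continuous_intros coord)
  then have "continuous_on cube (spindle k x y)"
    by (rule continuous_on_coordinatewise_then_product)
  moreover have "spindle k x y \<in> cube \<rightarrow> cube"
    using spindle_in_cube[OF assms] by blast
  ultimately show ?thesis
    by (simp add: hilbert_cube_eq)
qed

lemma spindle_ends:
  "z k = -1 \<Longrightarrow> spindle k x y z = x" "z k = 1 \<Longrightarrow> spindle k x y z = y"
  by (auto simp: spindle_def Let_def)

text \<open>As \<open>x k \<noteq> y k\<close>, coordinate \<open>k\<close> of the image determines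
  \<open>z k\<close>. Then \<open>w\<close> has the same weight \<open>s * (1 - s)\<close>, nonzero
  away from the ends, and the other coordinates can be solved for.\<close>

lemma spindle_inject:
  assumes eq: "spindle k x y z = spindle k x y w" and xy: "x k \<noteq> y k" and z: "z k \<noteq> -1" "z k \<noteq> 1"
  shows "z = w"
proof
  fix n
  have "(1 - (1 + z k) / 2) * x k + (1 + z k) / 2 * y k = (1 - (1 + w k) / 2) * x k + (1 + w k) / 2 * y k"
    using fun_cong[OF eq, of k] by (simp add: spindle_def)
  then have "(z k - w k) * (y k - x k) = 0"
    by (simp add: algebra_simps divide_simps)
  then have k: "z k = w k"
    using xy by simp
  show "z n = w n"
  proof (cases "n = k")
    case False
    then have "(1 + z k) / 2 * (1 - (1 + z k) / 2) * z n = (1 + z k) / 2 * (1 - (1 + z k) / 2) * w n"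
      using fun_cong[OF eq, of n] by (simp add: spindle_def Let_def flip: k)
    moreover have "(1 + z k) / 2 * (1 - (1 + z k) / 2) \<noteq> 0"
      using z by simp
    ultimately show ?thesis
      by (simp only: mult_cancel_left) simp
  qed (use k in simp)
qed

section \<open>The essential family in \<open>S\<close>\<close>

theorem theorem4:
  fixes S :: "(nat \<Rightarrow> real) set" and x y :: "nat \<Rightarrow> real"
  assumes "S \<subseteq> topspace hilbert_cube"
    and "x \<in> topspace hilbert_cube - S"
    and "y \<in> topspace hilbert_cube - S"
    and "\<And>C. \<lbrakk>continuum_in hilbert_cube C; x \<in> C; y \<in> C\<rbrakk> \<Longrightarrow> S \<inter> C \<noteq> {}"
  shows "strongly_infinite_dimensional (subtopology hilbert_cube S)"
proof -
  have S: "S \<subseteq> cube" and x: "x \<in> cube" "x \<notin> S" and y: "y \<in> cube" "y \<notin> S"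
    using assms(1-3) by auto
  have "x \<noteq> y"
  proof
    assume "x = y"
    moreover have "continuum_in hilbert_cube {x}"
      using x by (simp add: continuum_in_def)
    ultimately show False
      using assms(4)[of "{x}"] x by simp
  qed
  then obtain k where k: "x k \<noteq> y k"
    by auto
  let ?\<phi> = "spindle k x y"
  define T where "T = {z \<in> cube. ?\<phi> z \<in> S}"
  define A where "A i = S \<inter> ?\<phi> ` {z \<in> cube. z i \<le> -1/2}" for i
  define B where "B i = S \<inter> ?\<phi> ` {z \<in> cube. 1/2 \<le> z i}" for i
  have \<phi>: "continuous_map hilbert_cube hilbert_cube ?\<phi>"
    using x(1) y(1) by (rule continuous_map_spindle)
  have T: "T \<subseteq> cube"
    by (auto simp: T_def)
  \<comment> \<open>Points of \<open>T\<close> avoid the two collapsed faces, since these are sent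
    to \<open>x\<close> and \<open>y\<close>, which lie outside \<open>S\<close>.\<close>
  have inject: "z = w" if "z \<in> T" "?\<phi> z = ?\<phi> w" for z w
  proof (rule spindle_inject[OF that(2) k])
    show "z k \<noteq> -1" "z k \<noteq> 1"
      using that(1) x(2) y(2) spindle_ends[of z k x y] by (auto simp: T_def)
  qed
  have T_meets: "T \<inter> C \<noteq> {}"
    if C: "continuum_in hilbert_cube C" "\<exists>z\<in>C. z k = -1" "\<exists>z\<in>C. z k = 1" for C
  proof -
    have "x \<in> ?\<phi> ` C" "y \<in> ?\<phi> ` C"
      using C(2,3) spindle_ends[of _ k x y] by (metis imageI)+
    then have "S \<inter> ?\<phi> ` C \<noteq> {}"
      using assms(4) continuum_in_image[OF \<phi> C(1)] by blast
    moreover have "C \<subseteq> cube"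
      using C(1) compactin_subset_topspace[of hilbert_cube C] by (simp add: continuum_in_def)
    ultimately show ?thesis
      unfolding T_def by blast
  qed
  \<comment> \<open>A continuum in the face \<open>z i = -1\<close> along which \<open>z j = 0\<close> tells \<open>A i\<close> from \<open>A j\<close>.\<close>
  have "inj_on (\<lambda>i. (A i, B i)) (-{k})"
  proof (rule inj_onI, rule ccontr)
    fix i j
    assume ij: "i \<in> -{k}" "j \<in> -{k}" "(A i, B i) = (A j, B j)" "i \<noteq> j"
    define g :: "real \<Rightarrow> nat \<Rightarrow> real" where "g t = (\<lambda>_. 0)(k := t, i := -1)" for t
    have g: "g t \<in> cube" if "t \<in> {-1..1}" for t
      using that by (auto simp: g_def abs_le_iff)
    have "continuous_on {-1..1} g"
    proof (rule continuous_on_coordinatewise_then_product)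
      show "continuous_on {-1..1} (\<lambda>t. g t n)" for n
        by (cases "n = i"; cases "n = k") (auto simp: g_def)
    qed
    then have "continuous_map (top_of_set {-1..1}) hilbert_cube g"
      using g by (auto simp: hilbert_cube_eq)
    moreover have "continuum_in (top_of_set {-1..1}) {-1..1::real}"
      by (simp add: continuum_in_def compactin_subtopology connectedin_subtopology)
    ultimately have "continuum_in hilbert_cube (g ` {-1..1})"
      by (rule continuum_in_image)
    moreover have "g (-1) k = -1" "g 1 k = 1"
      using ij by (auto simp: g_def)
    ultimately have "T \<inter> g ` {-1..1} \<noteq> {}"
      by (intro T_meets) auto
    then obtain t where t: "t \<in> {-1..1}" "g t \<in> T"
      by blast
    have "?\<phi> (g t) \<in> A i"
      using t g[OF t(1)] by (auto simp: A_def T_def g_def)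
    then have "?\<phi> (g t) \<in> A j"
      using ij by simp
    then obtain w where w: "?\<phi> (g t) = ?\<phi> w" "w j \<le> -1/2"
      by (auto simp: A_def)
    have "g t j \<le> -1/2"
      using inject[OF t(2) w(1)] w(2) by simp
    then show False
      using ij by (auto simp: g_def)
  qed
  \<comment> \<open>The family is a set of pairs, so infinitely many indices yield an infinite
    family only because distinct indices give distinct pairs.\<close>
  moreover have "infinite (-{k})"
    by (simp add: infinite_UNIV_nat)
  ultimately have "infinite ((\<lambda>i. (A i, B i)) ` (-{k}))"
    using finite_imageD by blast
  moreover have "essential_family (subtopology hilbert_cube S) ((\<lambda>i. (A i, B i)) ` (-{k})) fst snd"
    unfolding essential_family_def
  proof (intro conjI ballI allI impI)
    \<comment> \<open>Closedness comes from compactness of the full slab in the cube, whose image is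
      taken before intersecting with \<open>S\<close>.\<close>
    have closed: "closedin (subtopology hilbert_cube S) (S \<inter> ?\<phi> ` E)" if "closedin hilbert_cube E" for E
    proof -
      have "compactin hilbert_cube (?\<phi> ` E)"
        using closedin_compact_space[OF compact_space_hilbert_cube that] \<phi> by (rule image_compactin)
      then show ?thesis
        using metrizable_imp_Hausdorff_space[OF metrizable_space_hilbert_cube]
        by (intro closedin_subtopology_Int_closed compactin_imp_closedin)
    qed
    fix p
    assume "p \<in> (\<lambda>i. (A i, B i)) ` (-{k})"
    then obtain i where p: "p = (A i, B i)"
      by (rule imageE)
    show "closedin (subtopology hilbert_cube S) (fst p)" "closedin (subtopology hilbert_cube S) (snd p)"
      unfolding p A_def B_def fst_conv snd_conv by (intro closed closedin_hilbert_cube_Collect_le)+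
    have False if v: "v \<in> A i" "v \<in> B i" for v
    proof -
      obtain z where z: "z \<in> cube" "v = ?\<phi> z" "z i \<le> -1/2"
        using v(1) unfolding A_def by blast
      obtain w where w: "v = ?\<phi> w" "1/2 \<le> w i"
        using v(2) unfolding B_def by blast
      have "z \<in> T"
        using v(1) z(1,2) by (simp add: A_def T_def)
      then have "z = w"
        by (rule inject) (use z(2) w(1) in metis)
      then show False
        using z(3) w(2) by simp
    qed
    then show "disjnt (fst p) (snd p)"
      unfolding p disjnt_iff fst_conv snd_conv by metis
  next
    fix L
    assume L: "\<forall>p\<in>(\<lambda>i. (A i, B i)) ` (-{k}). separator (subtopology hilbert_cube S) (fst p) (snd p) (L p)"
    have top_T: "topspace (subtopology hilbert_cube T) = T"
      using T by (intro topspace_subtopology_subset) simp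
    have \<phi>_T: "continuous_map (subtopology hilbert_cube T) (subtopology hilbert_cube S) ?\<phi>"
      unfolding continuous_map_in_subtopology top_T
      using continuous_map_from_subtopology[OF \<phi>] unfolding T_def by blast
    \<comment> \<open>Pulling back along \<open>?\<phi>\<close> turns the separators in
      \<open>S\<close> into separators of slabs in \<open>T\<close>, to which
      \<open>separators_meet\<close> applies; a common point there is mapped to a common point in
      \<open>S\<close>.\<close>
    have "separator (subtopology hilbert_cube T) {z \<in> T. z i \<le> -1/2} {z \<in> T. 1/2 \<le> z i}
        {z \<in> T. ?\<phi> z \<in> L (A i, B i)}" if "i \<noteq> k" for i
    proof -
      have "separator (subtopology hilbert_cube S) (A i) (B i) (L (A i, B i))"
        using bspec[OF L, of "(A i, B i)"] that by simp
      then show ?thesis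
      proof (rule separator_vimage[OF \<phi>_T, unfolded top_T])
        show "?\<phi> ` {z \<in> T. z i \<le> -1/2} \<subseteq> A i" "?\<phi> ` {z \<in> T. 1/2 \<le> z i} \<subseteq> B i"
          unfolding A_def B_def T_def by blast+
      qed blast+
    qed
    then have "T \<inter> (\<Inter>i\<in>-{k}. {z \<in> T. ?\<phi> z \<in> L (A i, B i)}) \<noteq> {}"
      by (intro separators_meet[OF T T_meets])
    then obtain z where z: "z \<in> T" "\<And>i. i \<noteq> k \<Longrightarrow> ?\<phi> z \<in> L (A i, B i)"
      by auto
    then have "?\<phi> z \<in> S" "?\<phi> z \<in> (\<Inter>p\<in>(\<lambda>i. (A i, B i)) ` (-{k}). L p)"
      unfolding T_def by blast+
    moreover have "topspace (subtopology hilbert_cube S) = S"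
      using assms(1) by (rule topspace_subtopology_subset)
    ultimately show "topspace (subtopology hilbert_cube S) \<inter> (\<Inter>p\<in>(\<lambda>i. (A i, B i)) ` (-{k}). L p) \<noteq> {}"
      by blast
  qed
  ultimately show ?thesis
    unfolding strongly_infinite_dimensional_def by blast
qed

end
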